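(* Let $T>\ell_0>0$, and let $(\ell,y)$ be a $C^1$-solution on $[0,T]$ of the debonding system with data $(\ell_0,y_0,y_1)$ and control $u$. Set $\bar\ell_0:=\ell(T)$, $\bar y_0:=y(T,\cdot)$, $\bar y_1:=\partial_ty(T,\cdot)$. Then one of the following holds: - $\ell'(T)=0$ and $\bar y_1(\bar\ell_0)=0$; - $\ell'(T)>0$ and $$2\,\kappa(\bar\ell_0)<|\bar y_0'(\bar\ell_0)|^2,\qquad \bar y_1(\bar\ell_0)=-\sqrt{1-\frac{2\kappa(\bar\ell_0)}{|\bar y_0'(\bar\ell_0)|^2}}\;\bar y_0'(\bar\ell_0).$$
   Context: Fix $0<c_1<c_2$ and a locally Lipschitz function $\kappa:[0,\infty)\to[c_1,c_2]$. Debonding system. Given $\ell_0>0$, $(y_0,y_1)$ on $[0,\ell_0]$ and a control $u$ on $[0,T]$, the unknowns are the front $\ell:[0,T]\to(0,\infty)$ and the displacement $y$ on $\{0\le t\le T,\ 0\le x\le \ell(t)\}$. The equations are $\partial_{tt}^2y-\partial_{xx}^2y=0$ for $0<x<\ell(t)$; $y(t,0)=u(t)$; $y(t,\ell(t))=0$; $y(0,\cdot)=y_0$; $\partial_ty(0,\cdot)=y_1$; together with Griffith's criterion $\ell'\ge0$, $G_{\ell'(t)}(t)\le\kappa(\ell(t))$, $\ell'(t)[G_{\ell'(t)}(t)-\kappa(\ell(t))]=0$, $\ell(0)=\ell_0$, where $G_{\ell'(t)}(t)=\frac12(1-\ell'(t)^2)(\partial_xy(t,\ell(t)))^2$. Solutions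 are understood through the following equivalent formulation. Put $\tau_\pm(t)=t\pm\ell(t)$ (strictly increasing). There is $f:[-\ell_0,T]\to\mathbb R$ with (1) $f(s)=\frac12\int_0^{-s}(y_0'-y_1)(\sigma)\,d\sigma$ for $s\in[-\ell_0,0]$; $f(s)=u(s)-u(0)-\frac12\int_0^s(y_0'+y_1)(\sigma)\,d\sigma$ for $s\in(0,\ell_0]$, $s\le T$; $f(s)=u(s)+f(\tau_-(\tau_+^{-1}(s)))$ for $s\in(\ell_0,T]$; (2) $\ell(0)=\ell_0$ and $\ell'(t)=\max\Big[\frac{2f'(t-\ell(t))^2-\kappa(\ell(t))}{2f'(t-\ell(t))^2+\kappa(\ell(t))},0\Big]$; (3) $y(t,x)=f(t-x)-g(t+x)$, where $g(s)=-u(0)-\frac12\int_0^s(y_0'+y_1)(\sigma)\,d\sigma$ for $0\le s\le\ell_0$ and $g(s)=f(\tau_-(\tau_+^{-1}(s)))$ for $\ell_0<s\le T+\ell(T)$ (i.e. $y(t,x)=u(t+x)-f(t+x)+f(t-x)$). A $C^1$-solution on $[0,T]$ (with $(y_0,y_1)\in C^1\times C^0$, $u\in C^1([0,T])$) is one with $\ell\in C^1([0,T])$, $y\in C^1(\{0\le t\le T,0\le x\le\ell(t)\})$, $f\in C^1([-\ell_0,T])$; all identities then hold pointwise. Derivatives in $t$ at $t=T$ are one-sided. *)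

theory Defs
  imports "HOL-Analysis.Analysis"
begin

text \<open>All functions are total in HOL; only their values on the stated domains matter. Hence every
  derivative is taken relative to the domain, and is one-sided at the end points of an interval.\<close>

abbreviation deriv_in :: "real set \<Rightarrow> (real \<Rightarrow> real) \<Rightarrow> real \<Rightarrow> real" where
  "deriv_in S h x \<equiv> vector_derivative h (at x within S)"

definition C1_on :: "real set \<Rightarrow> (real \<Rightarrow> real) \<Rightarrow> bool" where
  "C1_on S h \<longleftrightarrow> h differentiable_on S \<and> continuous_on S (deriv_in S h)"

definition space_time :: "real \<Rightarrow> (real \<Rightarrow> real) \<Rightarrow> (real \<times> real) set" where
  "space_time T l = {(t, x). 0 \<le> t \<and> t \<le> T \<and> 0 \<le> x \<and> x \<le> l t}"

text \<open>The partial derivatives are the components of the Frechet derivative relative to the closed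
  domain. A difference quotient in \<open>t\<close> alone would not do on the front: where \<open>l\<close> is strictly
  increasing, the points \<open>(s, l t)\<close> with \<open>s < t\<close> lie outside the domain. The relative Frechet
  derivative is unique on \<open>space_time T l\<close> when \<open>T > 0\<close> and \<open>l\<close> is positive and \<open>C\<^sup>1\<close>.\<close>

definition partial_t :: "(real \<times> real) set \<Rightarrow> (real \<Rightarrow> real \<Rightarrow> real) \<Rightarrow> real \<Rightarrow> real \<Rightarrow> real" where
  "partial_t Q y t x = frechet_derivative (\<lambda>(t, x). y t x) (at (t, x) within Q) (1, 0)"

definition partial_x :: "(real \<times> real) set \<Rightarrow> (real \<Rightarrow> real \<Rightarrow> real) \<Rightarrow> real \<Rightarrow> real \<Rightarrow> real" where
  "partial_x Q y t x = frechet_derivative (\<lambda>(t, x). y t x) (at (t, x) within Q) (0, 1)"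

definition C1_on2 :: "(real \<times> real) set \<Rightarrow> (real \<Rightarrow> real \<Rightarrow> real) \<Rightarrow> bool" where
  "C1_on2 Q y \<longleftrightarrow>
     (\<lambda>(t, x). y t x) differentiable_on Q \<and>
     continuous_on Q (\<lambda>(t, x). partial_t Q y t x) \<and>
     continuous_on Q (\<lambda>(t, x). partial_x Q y t x)"

text \<open>\<open>reflect T l\<close> is \<open>\<tau>\<^sub>- \<circ> \<tau>\<^sub>+\<^sup>-\<^sup>1\<close> with \<open>\<tau>\<^sub>\<plusminus>(t) = t \<plusminus> l t\<close> on \<open>[0,T]\<close>. The growth law
  \<open>front_eq\<close> below gives \<open>0 \<le> l' < 1\<close>, so both maps are strictly increasing there and the inverse
  is well defined on \<open>[l 0, T + l T]\<close>.\<close>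

definition reflect :: "real \<Rightarrow> (real \<Rightarrow> real) \<Rightarrow> real \<Rightarrow> real" where
  "reflect T l s = (let r = inv_into {0..T} (\<lambda>t. t + l t) s in r - l r)"

definition forward_wave_eq ::
  "real \<Rightarrow> real \<Rightarrow> (real \<Rightarrow> real) \<Rightarrow> (real \<Rightarrow> real) \<Rightarrow> (real \<Rightarrow> real) \<Rightarrow> (real \<Rightarrow> real) \<Rightarrow> (real \<Rightarrow> real) \<Rightarrow> bool"
where
  "forward_wave_eq T l0 y0 y1 u l f \<longleftrightarrow>
     (\<forall>s\<in>{-l0..0}. f s = 1/2 * integral {0..-s} (\<lambda>\<sigma>. deriv_in {0..l0} y0 \<sigma> - y1 \<sigma>)) \<and>
     (\<forall>s\<in>{0<..l0}. s \<le> T \<longrightarrow>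
        f s = u s - u 0 - 1/2 * integral {0..s} (\<lambda>\<sigma>. deriv_in {0..l0} y0 \<sigma> + y1 \<sigma>)) \<and>
     (\<forall>s\<in>{l0<..T}. f s = u s + f (reflect T l s))"

definition backward_wave_eq ::
  "real \<Rightarrow> real \<Rightarrow> (real \<Rightarrow> real) \<Rightarrow> (real \<Rightarrow> real) \<Rightarrow> (real \<Rightarrow> real) \<Rightarrow> (real \<Rightarrow> real) \<Rightarrow> (real \<Rightarrow> real)
     \<Rightarrow> (real \<Rightarrow> real) \<Rightarrow> bool"
where
  "backward_wave_eq T l0 y0 y1 u l f g \<longleftrightarrow>
     (\<forall>s\<in>{0..l0}. g s = - u 0 - 1/2 * integral {0..s} (\<lambda>\<sigma>. deriv_in {0..l0} y0 \<sigma> + y1 \<sigma>)) \<and>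
     (\<forall>s\<in>{l0<..T + l T}. g s = f (reflect T l s))"

definition front_eq ::
  "(real \<Rightarrow> real) \<Rightarrow> real \<Rightarrow> real \<Rightarrow> (real \<Rightarrow> real) \<Rightarrow> (real \<Rightarrow> real) \<Rightarrow> bool"
where
  "front_eq \<kappa> T l0 l f \<longleftrightarrow>
     l 0 = l0 \<and>
     (\<forall>t\<in>{0..T}. deriv_in {0..T} l t =
        max ((2 * (deriv_in {-l0..T} f (t - l t))\<^sup>2 - \<kappa> (l t)) /
             (2 * (deriv_in {-l0..T} f (t - l t))\<^sup>2 + \<kappa> (l t))) 0)"

text \<open>The wave equation, the boundary and initial conditions and Griffith's criterion are encoded
  through the d'Alembert representation \<open>y t x = f (t - x) - g (t + x)\<close>. It sees \<open>y0\<close> only through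
  its derivative, so that \<open>y 0 x = y0 x - y0 0 + u 0\<close>; the compatibility \<open>y0 0 = u 0\<close> is not
  part of the predicate.\<close>

definition C1_solution ::
  "(real \<Rightarrow> real) \<Rightarrow> real \<Rightarrow> real \<Rightarrow> (real \<Rightarrow> real) \<Rightarrow> (real \<Rightarrow> real) \<Rightarrow> (real \<Rightarrow> real) \<Rightarrow>
   (real \<Rightarrow> real) \<Rightarrow> (real \<Rightarrow> real \<Rightarrow> real) \<Rightarrow> bool"
where
  "C1_solution \<kappa> T l0 y0 y1 u l y \<longleftrightarrow>
     C1_on {0..l0} y0 \<and> continuous_on {0..l0} y1 \<and> C1_on {0..T} u \<and>
     (\<forall>t\<in>{0..T}. 0 < l t) \<and> C1_on {0..T} l \<and> C1_on2 (space_time T l) y \<and>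
     (\<exists>f g. C1_on {-l0..T} f \<and>
        forward_wave_eq T l0 y0 y1 u l f \<and>
        front_eq \<kappa> T l0 l f \<and>
        backward_wave_eq T l0 y0 y1 u l f g \<and>
        (\<forall>(t, x)\<in>space_time T l. y t x = f (t - x) - g (t + x)))"

end

theory Submission
  imports Defs
begin

text \<open>Let \<open>p = l' T\<close>, \<open>F = f' (T - l T)\<close>, and let \<open>a\<close>, \<open>b\<close> be the partial derivatives of
  \<open>y\<close> at \<open>(T, l T)\<close>. Differentiating \<open>y s (l s) = 0\<close> along the front gives \<open>a + p b = 0\<close>.
  Differentiating along the characteristic \<open>t - x = T - l T\<close>, parametrised by the front time \<open>s\<close>
  with \<open>t + x = s + l s\<close>, on which \<open>y = f (T - l T) - f (s - l s)\<close>, gives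
  \<open>(a + b) (1 + p) = - 2 F (1 - p)\<close>. Hence \<open>b = - 2 F / (1 + p)\<close>, and the growth law turns \<open>p > 0\<close>
  into \<open>b\<^sup>2 (1 - p\<^sup>2) = 2 \<kappa> (l T)\<close>.\<close>

lemma has_vector_derivative_deriv_in:
  assumes "C1_on S h" "x \<in> S"
  shows "(h has_vector_derivative deriv_in S h x) (at x within S)"
  using assms vector_derivative_works unfolding C1_on_def differentiable_on_def by blast

text \<open>Since \<kappa> is positive at \<open>l t\<close> and the square is nonnegative, the
  denominator of the growth law is positive and exceeds the numerator. The strict bound later allows
  division by \<open>1 - p\<close>.\<close>

lemma speed_in_unit_interval:
  assumes "front_eq \<kappa> T l0 l f" "t \<in> {0..T}" "0 < \<kappa> (l t)"
  shows "0 \<le> deriv_in {0..T} l t" "deriv_in {0..T} l t < 1"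
proof -
  define A where "A = 2 * (deriv_in {-l0..T} f (t - l t))\<^sup>2"
  have "0 \<le> A" by (simp add: A_def)
  moreover have "deriv_in {0..T} l t = max ((A - \<kappa> (l t)) / (A + \<kappa> (l t))) 0"
    using assms by (simp add: front_eq_def A_def)
  ultimately show "0 \<le> deriv_in {0..T} l t" "deriv_in {0..T} l t < 1"
    using assms(3) by (simp_all add: divide_less_eq)
qed

text \<open>Mean value theorem on \<open>{s..t}\<close>. Applied to the front, it says that the
  front never recedes and never outruns a characteristic of speed 1.\<close>

lemma increment_bounds:
  fixes h :: "real \<Rightarrow> real"
  assumes h: "C1_on {a..b} h"
    and d: "\<And>x. x \<in> {a..b} \<Longrightarrow> 0 \<le> deriv_in {a..b} h x \<and> deriv_in {a..b} h x < 1"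
    and st: "a \<le> s" "s \<le> t" "t \<le> b"
  shows "h s \<le> h t" "h t - h s \<le> t - s"
proof -
  have "(h has_derivative (\<lambda>v. v * deriv_in {a..b} h x)) (at x within {s..t})"
    if "s \<le> x" "x \<le> t" for x
    using has_vector_derivative_deriv_in[OF h, of x] that st
    by (auto simp: has_vector_derivative_def intro: has_derivative_subset)
  then obtain x where x: "x \<in> {s..t}" "h t - h s = (t - s) * deriv_in {a..b} h x"
    using mvt_very_simple[of s t h "\<lambda>x v. v * deriv_in {a..b} h x"] st by auto
  have "0 \<le> deriv_in {a..b} h x" "deriv_in {a..b} h x < 1" using d[of x] x(1) st by auto
  then show "h s \<le> h t" "h t - h s \<le> t - s"
    using x(2) st mult_left_le[of "deriv_in {a..b} h x" "t - s"]
      mult_nonneg_nonneg[of "t - s" "deriv_in {a..b} h x"]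
    by linarith+
qed

text \<open>Monotonicity of \<open>l\<close> makes \<open>t + l t\<close> injective on
  \<open>{0..T}\<close>, so \<open>inv_into\<close> recovers \<open>s\<close> from
  \<open>s + l s\<close>.\<close>

lemma reflect_front:
  assumes mono: "\<And>s t. 0 \<le> s \<Longrightarrow> s \<le> t \<Longrightarrow> t \<le> T \<Longrightarrow> l s \<le> l t" and s: "s \<in> {0..T}"
  shows "reflect T l (s + l s) = s - l s"
proof -
  have "inj_on (\<lambda>t. t + l t) {0..T}"
  proof (rule inj_onI)
    fix r t assume "r \<in> {0..T}" "t \<in> {0..T}" "r + l r = t + l t"
    then show "r = t" using mono[of r t] mono[of t r] by (cases "r \<le> t") auto
  qed
  then show ?thesis
    using s by (simp add: reflect_def inv_into_f_f[of "\<lambda>t. t + l t"])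
qed

text \<open>Chain rule for a derivative relative to \<open>Q\<close>: it suffices that the curve
  stays in \<open>Q\<close>, so \<open>c1 s, c2 s\<close> may be a boundary point, as the tip of the
  front is.\<close>

lemma has_vector_derivative_along_curve:
  fixes Y :: "real \<times> real \<Rightarrow> real"
  assumes Y: "(Y has_derivative D) (at (c1 s, c2 s) within Q)"
    and c: "(c1 has_vector_derivative v) (at s within S)" "(c2 has_vector_derivative w) (at s within S)"
    and sub: "\<And>r. r \<in> S \<Longrightarrow> (c1 r, c2 r) \<in> Q"
  shows "((\<lambda>r. Y (c1 r, c2 r)) has_vector_derivative v * D (1, 0) + w * D (0, 1)) (at s within S)"
proof -
  have "((\<lambda>r. (c1 r, c2 r)) has_derivative (\<lambda>h. (h *\<^sub>R v, h *\<^sub>R w))) (at s within S)"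
    using c unfolding has_vector_derivative_def by (rule has_derivative_Pair)
  moreover have "(Y has_derivative D) (at (c1 s, c2 s) within (\<lambda>r. (c1 r, c2 r)) ` S)"
    by (rule has_derivative_subset[OF Y]) (use sub in auto)
  ultimately have "(Y \<circ> (\<lambda>r. (c1 r, c2 r)) has_derivative D \<circ> (\<lambda>h. (h *\<^sub>R v, h *\<^sub>R w))) (at s within S)"
    by (rule diff_chain_within)
  moreover have "D (h * v, h * w) = h * (v * D (1, 0) + w * D (0, 1))" for h
  proof -
    interpret D: bounded_linear D using Y by (rule has_derivative_bounded_linear)
    have "(h * v, h * w) = (h * v) *\<^sub>R (1, 0) + (h * w) *\<^sub>R (0, 1)" by simp
    then have "D (h * v, h * w) = (h * v) *\<^sub>R D (1, 0) + (h * w) *\<^sub>R D (0, 1)"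
      by (metis D.add D.scaleR)
    then show ?thesis by (simp add: algebra_simps)
  qed
  ultimately show ?thesis by (simp add: has_vector_derivative_def o_def)
qed

text \<open>Two curves in the domain ending at \<open>(T, l T)\<close> give two linear equations for
  the partial derivatives. Both are parametrised by the front time \<open>s\<close>: then
  \<open>g (s + l s)\<close> becomes \<open>f (s - l s)\<close>, and only \<open>f\<close> and
  \<open>l\<close>, which are known to be differentiable, have to be differentiated.\<close>

lemma front_partial_derivatives:
  assumes l: "C1_on {0..T} l" and lpos: "\<And>t. t \<in> {0..T} \<Longrightarrow> 0 < l t" and T: "0 < T"
    and speed: "\<And>t. t \<in> {0..T} \<Longrightarrow> 0 \<le> deriv_in {0..T} l t \<and> deriv_in {0..T} l t < 1"
    and f: "C1_on {-l 0..T} f"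
    and g: "\<forall>s\<in>{l 0<..T + l T}. g s = f (reflect T l s)"
    and y: "\<forall>(t, x)\<in>space_time T l. y t x = f (t - x) - g (t + x)"
    and D: "((\<lambda>(t, x). y t x) has_derivative D) (at (T, l T) within space_time T l)"
  defines "p \<equiv> deriv_in {0..T} l T"
  shows "D (1, 0) = - p * D (0, 1)"
    and "D (0, 1) * (1 + p) = - 2 * deriv_in {-l 0..T} f (T - l T)"
proof -
  define F where "F = deriv_in {-l 0..T} f (T - l T)"
  note mono = increment_bounds(1)[OF l speed] and lip = increment_bounds(2)[OF l speed]
  \<comment> \<open>The bound \<open>T / 2\<close> keeps \<open>s\<close> positive, so that
    \<open>s + l s\<close> lies strictly above \<open>l 0\<close>, where \<open>g\<close> is given
    by reflection. The bound \<open>T - l T\<close> keeps the characteristic at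
    \<open>x \<ge> 0\<close>.\<close>
  define s0 where "s0 = max (T / 2) (T - l T)"
  have s0: "0 < s0" "s0 < T" "T - l T \<le> s0"
    using T lpos[of T] by (auto simp: s0_def)
  have gf: "g (s + l s) = f (s - l s)" if "s \<in> {s0..T}" for s
  proof -
    have "s + l s \<in> {l 0<..T + l T}" using that s0 mono[of 0 s] mono[of s T] by auto
    then show ?thesis using g reflect_front[of T l s] mono that s0 by auto
  qed
  have dl: "(l has_vector_derivative p) (at T within {s0..T})"
    unfolding p_def by (rule has_vector_derivative_within_subset[OF has_vector_derivative_deriv_in[OF l]])
      (use s0 T in auto)
  have uniq: "a = b" if "(h has_vector_derivative a) (at T within {s0..T})"
    "(h has_vector_derivative b) (at T within {s0..T})" for h :: "real \<Rightarrow> real" and a b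
    using vector_derivative_unique_within_closed_interval[of s0 T T h a b] that s0 by auto

  have front: "(s, l s) \<in> space_time T l" if "s \<in> {s0..T}" for s
    using that s0 lpos[of s] by (auto simp: space_time_def)
  have "((\<lambda>s. case (s, l s) of (t, x) \<Rightarrow> y t x) has_vector_derivative 1 * D (1, 0) + p * D (0, 1))
      (at T within {s0..T})"
    by (rule has_vector_derivative_along_curve[OF D has_vector_derivative_id[unfolded id_def] dl front])
  moreover have "((\<lambda>s. case (s, l s) of (t, x) \<Rightarrow> y t x) has_vector_derivative 0) (at T within {s0..T})"
  proof (rule has_vector_derivative_transform[OF _ _ has_vector_derivative_const[of 0]])
    show "T \<in> {s0..T}" using s0 by simp
    show "(case (s, l s) of (t, x) \<Rightarrow> y t x) = 0" if "s \<in> {s0..T}" for s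
      using y front[OF that] gf[OF that] by auto
  qed
  ultimately have a: "1 * D (1, 0) + p * D (0, 1) = 0" by (rule uniq)
  then show "D (1, 0) = - p * D (0, 1)" by simp

  define c1 where "c1 s = (s + l s + (T - l T)) / 2" for s
  define c2 where "c2 s = (s + l s - (T - l T)) / 2" for s
  \<comment> \<open>Backwards in time from \<open>(T, l T)\<close> the characteristic loses height
    at rate 1 and the front at a rate below 1, so the characteristic stays below the front.\<close>
  have char: "(c1 s, c2 s) \<in> space_time T l" if "s \<in> {s0..T}" for s
  proof -
    have 1: "l s \<le> l T" "l T - l s \<le> T - s" using mono[of s T] lip[of s T] that s0 by auto
    then have 2: "0 \<le> c1 s" "c1 s \<le> T" "0 \<le> c2 s"
      using that s0 lpos[of s] by (auto simp: c1_def c2_def)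
    then have "l T - l (c1 s) \<le> T - c1 s" using lip[of "c1 s" T] by auto
    then have "c2 s \<le> l (c1 s)" by (simp add: c1_def c2_def field_simps)
    with 2 show ?thesis by (simp add: space_time_def)
  qed
  have dc: "(c1 has_vector_derivative (1 + p) / 2) (at T within {s0..T})"
    "(c2 has_vector_derivative (1 + p) / 2) (at T within {s0..T})"
    using dl unfolding c1_def c2_def has_real_derivative_iff_has_vector_derivative[symmetric]
    by (auto intro!: derivative_eq_intros)
  have cT: "c1 T = T" "c2 T = l T" by (auto simp: c1_def c2_def)
  have "((\<lambda>s. case (c1 s, c2 s) of (t, x) \<Rightarrow> y t x) has_vector_derivative
      (1 + p) / 2 * D (1, 0) + (1 + p) / 2 * D (0, 1)) (at T within {s0..T})"
    by (rule has_vector_derivative_along_curve[OF _ dc char]) (use D in \<open>simp add: cT\<close>)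
  moreover have "((\<lambda>s. case (c1 s, c2 s) of (t, x) \<Rightarrow> y t x) has_vector_derivative - ((1 - p) * F))
      (at T within {s0..T})"
  proof (rule has_vector_derivative_transform)
    show "T \<in> {s0..T}" using s0 by simp
    show "(case (c1 s, c2 s) of (t, x) \<Rightarrow> y t x) = f (T - l T) - f (s - l s)" if "s \<in> {s0..T}" for s
    proof -
      have "c1 s - c2 s = T - l T" "c1 s + c2 s = s + l s" by (auto simp: c1_def c2_def field_simps)
      then show ?thesis using y char[OF that] gf[OF that] by auto
    qed
    \<comment> \<open>The lower end uses \<open>l s - l 0 \<le> s\<close>, the speed bound
      integrated from time 0.\<close>
    have range: "s - l s \<in> {-l 0..T}" if "s \<in> {s0..T}" for s
      using that s0 lip[of 0 s] lpos[of s] by auto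
    have "((\<lambda>s. s - l s) has_vector_derivative 1 - p) (at T within {s0..T})"
      by (intro derivative_intros dl has_vector_derivative_id[unfolded id_def])
    moreover have "(f has_vector_derivative F) (at (T - l T) within (\<lambda>s. s - l s) ` {s0..T})"
      unfolding F_def
      by (rule has_vector_derivative_within_subset[OF has_vector_derivative_deriv_in[OF f]])
        (use range s0 in auto)
    ultimately have "((\<lambda>s. f (s - l s)) has_vector_derivative (1 - p) * F) (at T within {s0..T})"
      using vector_diff_chain_within[of "\<lambda>s. s - l s" "1 - p" T "{s0..T}" f F] by (simp add: o_def)
    from has_vector_derivative_diff[OF has_vector_derivative_const this]
    show "((\<lambda>s. f (T - l T) - f (s - l s)) has_vector_derivative - ((1 - p) * F)) (at T within {s0..T})"
      by simp
  qed
  ultimately have "(1 + p) / 2 * D (1, 0) + (1 + p) / 2 * D (0, 1) = - ((1 - p) * F)" by (rule uniq)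
  \<comment> \<open>By \<open>a\<close>, the sum of the two partial derivatives is
    \<open>(1 - p) * D (0, 1)\<close>; the common factor then cancels because
    \<open>p < 1\<close>.\<close>
  with a have "(1 - p) * (D (0, 1) * (1 + p)) = (1 - p) * (- 2 * F)" by algebra
  moreover have "p < 1" using speed[of T] T by (simp add: p_def)
  ultimately have "D (0, 1) * (1 + p) = - 2 * F" using mult_left_cancel[of "1 - p"] by fastforce
  then show "D (0, 1) * (1 + p) = - 2 * deriv_in {-l 0..T} f (T - l T)" by (simp add: F_def)
qed

text \<open>For \<open>p > 0\<close> the maximum is its first argument, which rearranges to
  \<open>2 * F\<^sup>2 * (1 - p) = k * (1 + p)\<close>. Inserting
  \<open>4 * F\<^sup>2 = b\<^sup>2 * (1 + p)\<^sup>2\<close> and cancelling \<open>1 + p\<close>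
  leaves \<open>b\<^sup>2 * (1 - p\<^sup>2) = 2 * k\<close>, and both claims follow.\<close>

lemma growth_law_algebra:
  fixes p F k b :: real
  assumes k: "0 < k" and p: "p = max ((2 * F\<^sup>2 - k) / (2 * F\<^sup>2 + k)) 0" "0 < p" "p < 1"
    and b: "b * (1 + p) = - 2 * F"
  shows "2 * k < b\<^sup>2" "sqrt (1 - 2 * k / b\<^sup>2) = p"
proof -
  have "0 < 2 * F\<^sup>2 + k" using k by (simp add: add_nonneg_pos)
  moreover have "p = (2 * F\<^sup>2 - k) / (2 * F\<^sup>2 + k)" using p by (auto simp: max_def split: if_splits)
  ultimately have "p * (2 * F\<^sup>2 + k) = 2 * F\<^sup>2 - k" by simp
  with b have "(1 + p) * (b\<^sup>2 * (1 - p\<^sup>2)) = (1 + p) * (2 * k)" by algebra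
  then have eq: "b\<^sup>2 * (1 - p\<^sup>2) = 2 * k" using \<open>0 < p\<close> by simp
  then have "b \<noteq> 0" using k by auto
  then have b2: "0 < b\<^sup>2" by simp
  have "0 < b\<^sup>2 * p\<^sup>2" using b2 \<open>0 < p\<close> by simp
  with eq show "2 * k < b\<^sup>2" by (simp add: algebra_simps)
  have "2 * k / b\<^sup>2 = 1 - p\<^sup>2" using eq b2 by (simp add: field_simps)
  then show "sqrt (1 - 2 * k / b\<^sup>2) = p" using \<open>0 < p\<close> by simp
qed

theorem proposition3p3:
  fixes \<kappa> y0 y1 u l :: "real \<Rightarrow> real" and y :: "real \<Rightarrow> real \<Rightarrow> real"
    and c1 c2 T l0 lbar0 :: real and ybar0 ybar1 :: "real \<Rightarrow> real"
  assumes "0 < c1" and "c1 < c2"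
    and "local_lipschitz (UNIV :: real set) {0..} (\<lambda>_. \<kappa>)"
    and "\<forall>s\<ge>0. \<kappa> s \<in> {c1..c2}"
    and "0 < l0" and "l0 < T"
    and "C1_solution \<kappa> T l0 y0 y1 u l y"
    and "lbar0 = l T"
    and "ybar0 = (\<lambda>x. y T x)"
    and "ybar1 = (\<lambda>x. partial_t (space_time T l) y T x)"
  shows "(deriv_in {0..T} l T = 0 \<and> ybar1 lbar0 = 0) \<or>
    (deriv_in {0..T} l T > 0 \<and>
     2 * \<kappa> lbar0 < \<bar>deriv_in {0..lbar0} ybar0 lbar0\<bar>\<^sup>2 \<and>
     ybar1 lbar0 = - sqrt (1 - 2 * \<kappa> lbar0 / \<bar>deriv_in {0..lbar0} ybar0 lbar0\<bar>\<^sup>2)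
                     * deriv_in {0..lbar0} ybar0 lbar0)"
proof -
  obtain f g where lpos: "\<And>t. t \<in> {0..T} \<Longrightarrow> 0 < l t" and l: "C1_on {0..T} l"
    and y: "C1_on2 (space_time T l) y" and f: "C1_on {-l0..T} f" and front: "front_eq \<kappa> T l0 l f"
    and g: "backward_wave_eq T l0 y0 y1 u l f g"
    and yfg: "\<forall>(t, x)\<in>space_time T l. y t x = f (t - x) - g (t + x)"
    using assms(7) unfolding C1_solution_def by blast
  have T: "0 < T" and lT: "0 < l T" using assms(5,6) lpos[of T] by auto
  have kpos: "0 < \<kappa> (l t)" if "t \<in> {0..T}" for t
    using lpos[OF that] assms(1,4) by (smt (verit) atLeastAtMost_iff)
  note speed = speed_in_unit_interval[OF front _ kpos]
  have l0: "l 0 = l0" using front by (simp add: front_eq_def)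
  define Q where "Q = space_time T l"
  \<comment> \<open>With this choice \<open>ybar1 lbar0\<close> is \<open>D (1, 0)\<close> by
    definition; the derivative of \<open>ybar0\<close> is identified with \<open>D (0, 1)\<close>
    below, along the slice \<open>t = T\<close>.\<close>
  define D where "D = frechet_derivative (\<lambda>(t, x). y t x) (at (T, l T) within Q)"
  define p where "p = deriv_in {0..T} l T"
  define F where "F = deriv_in {-l0..T} f (T - l T)"
  have "(T, l T) \<in> Q" using T lT by (simp add: Q_def space_time_def)
  then have D: "((\<lambda>(t, x). y t x) has_derivative D) (at (T, l T) within Q)"
    using y unfolding D_def C1_on2_def Q_def differentiable_on_def frechet_derivative_works by blast
  have a: "D (1, 0) = - p * D (0, 1)" and b: "D (0, 1) * (1 + p) = - 2 * F"
    using front_partial_derivatives[OF l lpos T _ _ _ yfg D[unfolded Q_def]] speed f g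
    by (auto simp: l0 p_def F_def backward_wave_eq_def)
  have "((\<lambda>x. case (T, x) of (t, x) \<Rightarrow> y t x) has_vector_derivative 0 * D (1, 0) + 1 * D (0, 1))
      (at (l T) within {0..l T})"
    by (rule has_vector_derivative_along_curve[OF D has_vector_derivative_const
          has_vector_derivative_id[unfolded id_def]])
      (use T in \<open>auto simp: Q_def space_time_def\<close>)
  then have "(ybar0 has_vector_derivative D (0, 1)) (at (l T) within {0..l T})"
    by (simp add: assms(9))
  then have y0': "deriv_in {0..lbar0} ybar0 lbar0 = D (0, 1)"
    using vector_derivative_within_closed_interval[of 0 "l T" "l T" ybar0 "D (0, 1)"] lT
    by (simp add: assms(8))
  have y1': "ybar1 lbar0 = D (1, 0)" by (simp add: assms(8,10) partial_t_def D_def Q_def)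
  have p: "p = max ((2 * F\<^sup>2 - \<kappa> (l T)) / (2 * F\<^sup>2 + \<kappa> (l T))) 0"
    using front T by (simp add: front_eq_def p_def F_def)
  have "0 \<le> p" "p < 1" using speed[of T] T by (auto simp: p_def)
  then consider "p = 0" | "0 < p" by linarith
  then show ?thesis
  proof cases
    case 1
    \<comment> \<open>A front at rest at time \<open>T\<close> turns \<open>a\<close> into
      \<open>D (1, 0) = 0\<close>.\<close>
    then show ?thesis using a y1' by (simp add: p_def)
  next
    case 2
    have "0 < \<kappa> (l T)" using kpos T by simp
    note growth_law_algebra[OF this p 2 \<open>p < 1\<close> b]
    then show ?thesis using 2 a unfolding y0' y1' by (simp add: p_def assms(8))
  qed
qed

end
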